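(* Let $(V_4,g)$ be a $4$-dimensional spacetime which is $W$-flat (i.e. $W_{abcd}=0$) and satisfies the Einstein field equations with a cosmological term, $R_{bc}-\frac12 R g_{bc}+\Lambda g_{bc}=k\,T_{bc}$. Then a vector field $\xi$ on $V_4$ is a Killing vector field, i.e. $\mathcal L_\xi g_{bc}=0$, if and only if the Lie derivative of the energy-momentum tensor with respect to $\xi$ vanishes, i.e. $\mathcal L_\xi T_{bc}=0$.
   Context: A spacetime $V_4$ is a $4$-dimensional Lorentzian manifold with metric $g_{ab}$ of signature $(-,+,+,+)$ and Levi-Civita connection $\nabla$. The Riemann tensor is $R(X,Y,Z,T)=g(\nabla_X\nabla_YZ-\nabla_Y\nabla_XZ-\nabla_{[X,Y]}Z,T)$, with components $R_{abcd}$; the Ricci tensor is $R_{bc}=g^{ad}R_{abcd}$ and the scalar curvature is $R=g^{bc}R_{bc}$. The $W$-curvature tensor of $V_4$ is $W_{abcd}=R_{abcd}+\frac13\left[g_{ac}R_{bd}-g_{bc}R_{ad}\right]$. The spacetime is called $W$-flat if $W_{abcd}=0$ everywhere. $\Lambda$ is the cosmological constant, $k$ is the non-zero gravitational constant, $T_{bc}$ is the energy-momentum tensor, and $\mathcal L_\xi$ is the Lie derivative along $\xi$.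
   Formalization: The formal theorem also assumes that T is not identically zero on any connected component of the spacetime; without this the claim fails, e.g. in Minkowski space with Λ = 0, T = 0, every ξ has vanishing Lie derivative of T, Killing or not. *)

theory Defs
  imports "HOL-Analysis.Analysis"
begin

section \<open>Smooth maps on open subsets of coordinate space\<close>

definition pd :: "4 \<Rightarrow> (real^4 \<Rightarrow> 'b::real_normed_vector) \<Rightarrow> real^4 \<Rightarrow> 'b" where
  "pd i f x = frechet_derivative f (at x) (axis i 1)"

text \<open>\<open>C\<^sup>\<infinity>\<close>: every iterated partial derivative exists and is (Frechet) differentiable.
  Meant for open \<open>S\<close>.\<close>

definition smooth_on :: "(real^4) set \<Rightarrow> (real^4 \<Rightarrow> 'b::real_normed_vector) \<Rightarrow> bool" where
  "smooth_on S f \<longleftrightarrow> (\<forall>is. foldr pd is f differentiable_on S)"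


section \<open>Smooth 4-manifolds\<close>

text \<open>The manifold is a Hausdorff, second countable type \<open>'m\<close>. A chart is a pair of its domain
  and its coordinate map.\<close>

type_synonym 'm chart = "'m set \<times> ('m \<Rightarrow> real^4)"

abbreviation chart_dom :: "'m chart \<Rightarrow> 'm set" where
  "chart_dom c \<equiv> fst c"

abbreviation coord :: "'m chart \<Rightarrow> 'm \<Rightarrow> real^4" where
  "coord c \<equiv> snd c"

abbreviation chart_range :: "'m chart \<Rightarrow> (real^4) set" where
  "chart_range c \<equiv> coord c ` chart_dom c"

definition is_chart :: "'m::topological_space chart \<Rightarrow> bool" where
  "is_chart c \<longleftrightarrow> open (chart_dom c) \<and> open (chart_range c) \<and>
     homeomorphism (chart_dom c) (chart_range c) (coord c) (inv_into (chart_dom c) (coord c))"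

definition overlap :: "'m chart \<Rightarrow> 'm chart \<Rightarrow> (real^4) set" where
  "overlap c c' = coord c ` (chart_dom c \<inter> chart_dom c')"

definition transition :: "'m chart \<Rightarrow> 'm chart \<Rightarrow> real^4 \<Rightarrow> real^4" where
  "transition c c' = coord c' \<circ> inv_into (chart_dom c) (coord c)"

definition smooth_atlas :: "'m::{t2_space, second_countable_topology} chart set \<Rightarrow> bool" where
  "smooth_atlas A \<longleftrightarrow>
     (\<forall>c\<in>A. is_chart c) \<and> (\<Union>c\<in>A. chart_dom c) = UNIV \<and>
     (\<forall>c\<in>A. \<forall>c'\<in>A. smooth_on (overlap c c') (transition c c'))"


section \<open>Tensor fields\<close>

text \<open>A tensor field is given by its components in every chart of the atlas, as functions of the
  coordinates, subject to the transformation law. Values at charts outside the atlas or at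
  coordinates outside the range of the chart are irrelevant.\<close>

type_synonym 'm vfield = "'m chart \<Rightarrow> real^4 \<Rightarrow> real^4"
type_synonym 'm tfield = "'m chart \<Rightarrow> real^4 \<Rightarrow> real^4^4"

definition vector_field :: "'m chart set \<Rightarrow> 'm vfield \<Rightarrow> bool" where
  "vector_field A \<xi> \<longleftrightarrow>
     (\<forall>c\<in>A. smooth_on (chart_range c) (\<xi> c)) \<and>
     (\<forall>c\<in>A. \<forall>c'\<in>A. \<forall>x\<in>overlap c c'.
        \<xi> c' (transition c c' x) = jacobian (transition c c') (at x) *v \<xi> c x)"

text \<open>Tensor fields of type (0,2): \<open>T c x $ i $ j\<close> is the component \<open>T\<^sub>i\<^sub>j\<close>.\<close>

definition tensor_field :: "'m chart set \<Rightarrow> 'm tfield \<Rightarrow> bool" where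
  "tensor_field A T \<longleftrightarrow>
     (\<forall>c\<in>A. smooth_on (chart_range c) (T c)) \<and>
     (\<forall>c\<in>A. \<forall>c'\<in>A. \<forall>x\<in>overlap c c'.
        T c x = transpose (jacobian (transition c c') (at x))
                  ** T c' (transition c c' x) ** jacobian (transition c c') (at x))"

text \<open>The index type \<open>4\<close> has the elements 0, 1, 2, 3.\<close>

definition minkowski :: "real^4^4" where
  "minkowski = (\<chi> i j. if i \<noteq> j then 0 else if i = 0 then -1 else 1)"

definition lorentzian_form :: "real^4^4 \<Rightarrow> bool" where
  "lorentzian_form G \<longleftrightarrow> (\<exists>P. invertible P \<and> transpose P ** G ** P = minkowski)"

definition lorentzian_metric :: "'m chart set \<Rightarrow> 'm tfield \<Rightarrow> bool" where
  "lorentzian_metric A g \<longleftrightarrow>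
     tensor_field A g \<and> (\<forall>c\<in>A. \<forall>x\<in>chart_range c. lorentzian_form (g c x))"

definition spacetime :: "'m::{t2_space, second_countable_topology} chart set \<Rightarrow> 'm tfield \<Rightarrow> bool" where
  "spacetime A g \<longleftrightarrow> smooth_atlas A \<and> lorentzian_metric A g"


section \<open>Levi-Civita connection and curvature in a chart\<close>

text \<open>Here \<open>g\<close> is the component matrix of the metric in one chart;
  \<open>christoffel g x k i j\<close> is \<open>\<Gamma>\<^sup>k\<^sub>i\<^sub>j\<close>.\<close>

definition christoffel :: "(real^4 \<Rightarrow> real^4^4) \<Rightarrow> real^4 \<Rightarrow> 4 \<Rightarrow> 4 \<Rightarrow> 4 \<Rightarrow> real" where
  "christoffel g x k i j = 1/2 * (\<Sum>l\<in>UNIV. matrix_inv (g x) $ k $ l *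
     (pd i g x $ j $ l + pd j g x $ i $ l - pd l g x $ i $ j))"

definition nabla :: "(real^4 \<Rightarrow> real^4^4) \<Rightarrow> (real^4 \<Rightarrow> real^4) \<Rightarrow> (real^4 \<Rightarrow> real^4) \<Rightarrow> real^4 \<Rightarrow> real^4"
  where
  "nabla g X Y x = (\<chi> k. \<Sum>i\<in>UNIV. X x $ i *
     (pd i Y x $ k + (\<Sum>j\<in>UNIV. christoffel g x k i j * Y x $ j)))"

definition lie_bracket :: "(real^4 \<Rightarrow> real^4) \<Rightarrow> (real^4 \<Rightarrow> real^4) \<Rightarrow> real^4 \<Rightarrow> real^4" where
  "lie_bracket X Y x = (\<chi> k. \<Sum>i\<in>UNIV. X x $ i * pd i Y x $ k - Y x $ i * pd i X x $ k)"

definition riemann_op :: "(real^4 \<Rightarrow> real^4^4) \<Rightarrow> (real^4 \<Rightarrow> real^4) \<Rightarrow> (real^4 \<Rightarrow> real^4) \<Rightarrow>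
    (real^4 \<Rightarrow> real^4) \<Rightarrow> real^4 \<Rightarrow> real^4" where
  "riemann_op g X Y Z x =
     nabla g X (nabla g Y Z) x - nabla g Y (nabla g X Z) x - nabla g (lie_bracket X Y) Z x"

definition coord_field :: "4 \<Rightarrow> real^4 \<Rightarrow> real^4" where
  "coord_field i = (\<lambda>x. axis i 1)"

text \<open>\<open>R\<^sub>a\<^sub>b\<^sub>c\<^sub>d = g(R(\<partial>\<^sub>a,\<partial>\<^sub>b)\<partial>\<^sub>c, \<partial>\<^sub>d)\<close>.\<close>

definition riemann :: "(real^4 \<Rightarrow> real^4^4) \<Rightarrow> real^4 \<Rightarrow> 4 \<Rightarrow> 4 \<Rightarrow> 4 \<Rightarrow> 4 \<Rightarrow> real" where
  "riemann g x a b c d =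
     riemann_op g (coord_field a) (coord_field b) (coord_field c) x \<bullet> (g x *v coord_field d x)"

definition ricci :: "(real^4 \<Rightarrow> real^4^4) \<Rightarrow> real^4 \<Rightarrow> 4 \<Rightarrow> 4 \<Rightarrow> real" where
  "ricci g x b c = (\<Sum>a\<in>UNIV. \<Sum>d\<in>UNIV. matrix_inv (g x) $ a $ d * riemann g x a b c d)"

definition scalar_curv :: "(real^4 \<Rightarrow> real^4^4) \<Rightarrow> real^4 \<Rightarrow> real" where
  "scalar_curv g x = (\<Sum>b\<in>UNIV. \<Sum>c\<in>UNIV. matrix_inv (g x) $ b $ c * ricci g x b c)"

definition w_curv :: "(real^4 \<Rightarrow> real^4^4) \<Rightarrow> real^4 \<Rightarrow> 4 \<Rightarrow> 4 \<Rightarrow> 4 \<Rightarrow> 4 \<Rightarrow> real" where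
  "w_curv g x a b c d = riemann g x a b c d
     + 1/3 * (g x $ a $ c * ricci g x b d - g x $ b $ c * ricci g x a d)"

definition W_flat :: "'m chart set \<Rightarrow> 'm tfield \<Rightarrow> bool" where
  "W_flat A g \<longleftrightarrow> (\<forall>ch\<in>A. \<forall>x\<in>chart_range ch. \<forall>a b c d. w_curv (g ch) x a b c d = 0)"

definition einstein_equations :: "'m chart set \<Rightarrow> 'm tfield \<Rightarrow> real \<Rightarrow> real \<Rightarrow> 'm tfield \<Rightarrow> bool" where
  "einstein_equations A g \<Lambda> k T \<longleftrightarrow> (\<forall>ch\<in>A. \<forall>x\<in>chart_range ch. \<forall>b c.
     ricci (g ch) x b c - 1/2 * scalar_curv (g ch) x * g ch x $ b $ c + \<Lambda> * g ch x $ b $ c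
       = k * T ch x $ b $ c)"


section \<open>Lie derivative and Killing fields\<close>

text \<open>\<open>(\<L>\<^sub>\<xi> T)\<^sub>b\<^sub>c = \<xi>\<^sup>a \<partial>\<^sub>a T\<^sub>b\<^sub>c + T\<^sub>a\<^sub>c \<partial>\<^sub>b \<xi>\<^sup>a + T\<^sub>b\<^sub>a \<partial>\<^sub>c \<xi>\<^sup>a\<close>.\<close>

definition lie_deriv :: "'m vfield \<Rightarrow> 'm tfield \<Rightarrow> 'm tfield" where
  "lie_deriv \<xi> T ch x = (\<chi> b c. \<Sum>a\<in>UNIV. \<xi> ch x $ a * pd a (T ch) x $ b $ c
      + T ch x $ a $ c * pd b (\<xi> ch) x $ a + T ch x $ b $ a * pd c (\<xi> ch) x $ a)"

definition vanishes :: "'m chart set \<Rightarrow> 'm tfield \<Rightarrow> bool" where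
  "vanishes A T \<longleftrightarrow> (\<forall>ch\<in>A. \<forall>x\<in>chart_range ch. T ch x = 0)"

definition killing_field :: "'m chart set \<Rightarrow> 'm tfield \<Rightarrow> 'm vfield \<Rightarrow> bool" where
  "killing_field A g \<xi> \<longleftrightarrow> vanishes A (lie_deriv \<xi> g)"

text \<open>Matter is present: \<open>T\<close> is not identically zero on any connected component (for connected
  spacetimes: \<open>T \<noteq> 0\<close> somewhere). The vacuum case has to be excluded, since for \<open>T = 0\<close> every
  vector field satisfies \<open>\<L>\<^sub>\<xi> T = 0\<close>, Killing or not; for instance in Minkowski space, which is
  \<open>W\<close>-flat and solves the field equations with \<open>\<Lambda> = 0\<close> and \<open>T = 0\<close>.\<close>

definition non_vacuum :: "'m::topological_space chart set \<Rightarrow> 'm tfield \<Rightarrow> bool" where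
  "non_vacuum A T \<longleftrightarrow>
     (\<forall>C\<in>components UNIV. \<exists>ch\<in>A. \<exists>p\<in>chart_dom ch \<inter> C. T ch (coord ch p) \<noteq> 0)"


section \<open>The connection is the Levi-Civita connection\<close>

lemma lorentzian_form_invertible:
  assumes "lorentzian_form G"
  shows "invertible G"
proof -
  obtain P where P: "invertible P" "transpose P ** G ** P = minkowski"
    using assms by (auto simp: lorentzian_form_def)
  have "det minkowski = (\<Prod>i\<in>(UNIV :: 4 set). minkowski $ i $ i)"
    by (rule det_diagonal) (simp add: minkowski_def)
  also have "\<dots> \<noteq> 0"
    by (simp add: minkowski_def)
  finally show ?thesis
    using P(2) by (metis det_mul invertible_det_nz mult_zero_left mult_zero_right)
qed

lemma lorentzian_form_symmetric:
  assumes "lorentzian_form G"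
  shows "transpose G = G"
proof -
  obtain P where P: "invertible P" "transpose P ** G ** P = minkowski"
    using assms by (auto simp: lorentzian_form_def)
  obtain Q where Q: "P ** Q = mat 1"
    using P(1) by (auto simp: invertible_def)
  have Qt: "transpose Q ** transpose P = mat 1"
    by (metis Q matrix_transpose_mul transpose_mat)
  have "transpose Q ** minkowski ** Q = (transpose Q ** transpose P) ** G ** (P ** Q)"
    by (simp add: P(2)[symmetric] matrix_mul_assoc)
  then have G: "G = transpose Q ** minkowski ** Q"
    by (simp add: Q Qt)
  have "transpose minkowski = minkowski"
    by (auto simp: transpose_def minkowski_def vec_eq_iff)
  then show ?thesis
    by (simp add: G matrix_transpose_mul matrix_mul_assoc)
qed

context
  fixes g :: "real^4 \<Rightarrow> real^4^4" and S :: "(real^4) set" and x :: "real^4"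
  assumes S: "open S" "x \<in> S" and g: "g differentiable_on S" "\<And>y. y \<in> S \<Longrightarrow> lorentzian_form (g y)"
begin

lemma pd_metric_sym: "pd i g x $ j $ k = pd i g x $ k $ j"
proof -
  have D: "(g has_derivative frechet_derivative g (at x)) (at x)"
    using g(1) S by (simp add: differentiable_on_eq_differentiable_at frechet_derivative_works)
  have comp: "((\<lambda>y. g y $ a $ b) has_derivative (\<lambda>h. frechet_derivative g (at x) h $ a $ b)) (at x)"
    for a b
    by (rule bounded_linear.has_derivative[OF bounded_linear_vec_nth
          bounded_linear.has_derivative[OF bounded_linear_vec_nth D]])
  have sym: "g y $ j $ k = g y $ k $ j" if "y \<in> S" for y
    using arg_cong[OF lorentzian_form_symmetric[OF g(2)[OF that]], of "\<lambda>G. G $ k $ j"]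
    by (simp add: transpose_def)
  have "((\<lambda>y. g y $ k $ j) has_derivative (\<lambda>h. frechet_derivative g (at x) h $ j $ k)) (at x)"
    by (rule has_derivative_transform_within_open[OF comp[of j k] S sym])
  from has_derivative_unique[OF this comp[of k j]] show ?thesis
    by (simp add: pd_def fun_eq_iff)
qed

lemma nabla_torsion_free: "nabla g X Y x - nabla g Y X x = lie_bracket X Y x"
proof -
  have G: "christoffel g x k i j = christoffel g x k j i" for i j k
    unfolding christoffel_def
    by (intro arg_cong[of _ _ "\<lambda>s. 1/2 * s"] sum.cong refl) (metis pd_metric_sym add.commute)
  have "(\<Sum>i\<in>UNIV. X x $ i * (\<Sum>j\<in>UNIV. christoffel g x k i j * Y x $ j)) =
        (\<Sum>i\<in>UNIV. Y x $ i * (\<Sum>j\<in>UNIV. christoffel g x k i j * X x $ j))" for k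
  proof -
    have "(\<Sum>i\<in>UNIV. \<Sum>j\<in>UNIV. X x $ i * (christoffel g x k i j * Y x $ j)) =
          (\<Sum>j\<in>UNIV. \<Sum>i\<in>UNIV. X x $ i * (christoffel g x k i j * Y x $ j))"
      by (rule sum.swap)
    also have "\<dots> = (\<Sum>j\<in>UNIV. \<Sum>i\<in>UNIV. Y x $ j * (christoffel g x k j i * X x $ i))"
      by (intro sum.cong refl) (metis G mult.commute mult.left_commute)
    finally show ?thesis
      by (simp only: sum_distrib_left)
  qed
  then show ?thesis
    by (simp add: vec_eq_iff nabla_def lie_bracket_def distrib_left sum.distrib sum_subtractf)
qed

lemma nabla_metric:
  "pd k g x $ i $ j = (\<Sum>l\<in>UNIV. christoffel g x l k i * g x $ l $ j)
                    + (\<Sum>l\<in>UNIV. christoffel g x l k j * g x $ i $ l)"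
proof -
  have inv: "invertible (g x)"
    using g(2) S lorentzian_form_invertible by blast
  have sym: "g x $ a $ b = g x $ b $ a" for a b
    using arg_cong[OF lorentzian_form_symmetric[OF g(2)[OF S(2)]], of "\<lambda>G. G $ b $ a"]
    by (simp add: transpose_def)
  have I: "(\<Sum>l\<in>UNIV. g x $ m $ l * matrix_inv (g x) $ l $ n) = (if m = n then 1 else 0)" for m n
  proof -
    have "g x ** matrix_inv (g x) = mat 1"
      using someI_ex[OF inv[unfolded invertible_def]] unfolding matrix_inv_def by (rule conjunct1)
    from arg_cong[OF this, of "\<lambda>G. G $ m $ n"] show ?thesis
      by (simp add: matrix_matrix_mult_def mat_def)
  qed
  have low: "(\<Sum>l\<in>UNIV. christoffel g x l a b * g x $ m $ l) =
      1/2 * (pd a g x $ b $ m + pd b g x $ a $ m - pd m g x $ a $ b)" for a b m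
  proof -
    have "(\<Sum>l\<in>UNIV. christoffel g x l a b * g x $ m $ l) =
      (\<Sum>l\<in>UNIV. \<Sum>n\<in>UNIV. (g x $ m $ l * matrix_inv (g x) $ l $ n) *
         (1/2 * (pd a g x $ b $ n + pd b g x $ a $ n - pd n g x $ a $ b)))"
      unfolding christoffel_def sum_distrib_left sum_distrib_right
      by (intro sum.cong refl) (simp add: algebra_simps)
    also have "\<dots> = (\<Sum>n\<in>UNIV. (\<Sum>l\<in>UNIV. g x $ m $ l * matrix_inv (g x) $ l $ n) *
         (1/2 * (pd a g x $ b $ n + pd b g x $ a $ n - pd n g x $ a $ b)))"
      by (subst sum.swap) (simp only: sum_distrib_right)
    also have "\<dots> = 1/2 * (pd a g x $ b $ m + pd b g x $ a $ m - pd m g x $ a $ b)"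
      by (simp only: I if_distrib[of "\<lambda>u. u * _"] mult_1_left mult_zero_left
            sum.delta'[OF finite] UNIV_I if_True)
    finally show ?thesis .
  qed
  show ?thesis
  proof -
    have "(\<Sum>l\<in>UNIV. christoffel g x l k i * g x $ l $ j) =
          (\<Sum>l\<in>UNIV. christoffel g x l k i * g x $ j $ l)"
      by (intro sum.cong refl) (metis sym)
    then show ?thesis
      using low[of k i j] low[of k j i] pd_metric_sym[of k j i] pd_metric_sym[of i j k]
        pd_metric_sym[of j i k]
      by argo
  qed
qed

end

end

theory Submission
  imports Defs
begin

text \<open>Contracting the skew-symmetry of the curvature tensor in its last two indices shows that a
  \<open>W\<close>-flat metric is Einstein, \<open>R\<^sub>a\<^sub>d = (R / 4) g\<^sub>a\<^sub>d\<close>, so that its curvature has the form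
  \<open>R\<^sub>a\<^sub>b\<^sub>c\<^sub>d = (R / 12) (g\<^sub>b\<^sub>c g\<^sub>a\<^sub>d - g\<^sub>a\<^sub>c g\<^sub>b\<^sub>d)\<close>. By the second Bianchi identity \<open>R\<close> is then locally
  constant (Schur), and the field equations read \<open>T = ((\<Lambda> - R / 4) / k) g\<close> with a locally constant
  factor. This factor does not vanish anywhere, because matter is present on every connected component.
  Hence the Lie derivatives of \<open>T\<close> and \<open>g\<close> are proportional with a non-zero factor.

  Curvature is computed with matrix-valued functions: the Christoffel symbols form matrices
  \<open>\<Gamma>\<^sub>a = (\<Gamma>\<^sup>k\<^sub>a\<^sub>c)\<^sub>k\<^sub>c\<close>, and the curvature is \<open>F\<^sub>a\<^sub>b = \<partial>\<^sub>a \<Gamma>\<^sub>b - \<partial>\<^sub>b \<Gamma>\<^sub>a + \<Gamma>\<^sub>a \<Gamma>\<^sub>b - \<Gamma>\<^sub>b \<Gamma>\<^sub>a\<close>.\<close>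

section \<open>Partial derivatives\<close>

text \<open>The second difference is symmetric in \<open>u\<close> and \<open>v\<close>, so that this limit gives the symmetry of
  mixed derivatives without assuming that they are continuous.\<close>

lemma second_difference_limit:
  fixes f :: "'a::real_normed_vector \<Rightarrow> real"
  assumes S: "open S" "x \<in> S"
    and f: "\<And>y. y \<in> S \<Longrightarrow> (f has_derivative f' y) (at y)"
    and D: "((\<lambda>y. f' y u) has_derivative D) (at x)"
  shows "((\<lambda>t. (f (x + t *\<^sub>R u + t *\<^sub>R v) - f (x + t *\<^sub>R u) - f (x + t *\<^sub>R v) + f x) / t\<^sup>2)
           \<longlongrightarrow> D v) (at_right 0)"
proof (rule tendstoI)
  fix e :: real
  assume e: "e > 0"
  define M where "M = norm u + norm v + 1"
  have M: "M > 0" "norm u + norm v \<le> M"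
    by (auto simp: M_def add_nonneg_pos)
  interpret D: bounded_linear D
    using D by (rule has_derivative_bounded_linear)
  \<comment> \<open>Two remainders of size at most \<open>\<epsilon> * (t * M)\<close> occur below;
    the factor 3 makes their sum strictly less than \<open>t * e\<close>.\<close>
  define \<epsilon> where "\<epsilon> = e / (3 * M)"
  have "\<epsilon> > 0"
    using e M by (simp add: \<epsilon>_def)
  then obtain d where d: "d > 0"
    "\<And>y. norm (y - x) < d \<Longrightarrow> norm (f' y u - f' x u - D (y - x)) \<le> \<epsilon> * norm (y - x)"
    using D unfolding has_derivative_at_alt by blast
  obtain r where r: "r > 0" "ball x r \<subseteq> S"
    using S open_contains_ball by blast
  have near: "norm (s *\<^sub>R u + s' *\<^sub>R v) \<le> t * M" if "0 \<le> s" "s \<le> t" "0 \<le> s'" "s' \<le> t" for s s' t :: real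
  proof -
    have "norm (s *\<^sub>R u + s' *\<^sub>R v) \<le> s * norm u + s' * norm v"
      using norm_triangle_ineq[of "s *\<^sub>R u" "s' *\<^sub>R v"] that by simp
    also have "\<dots> \<le> t * norm u + t * norm v"
      using that by (intro add_mono mult_right_mono) auto
    also have "\<dots> \<le> t * M"
      using mult_left_mono[OF M(2), of t] that by (simp add: distrib_left)
    finally show ?thesis .
  qed
  have main: "dist ((f (x + t *\<^sub>R u + t *\<^sub>R v) - f (x + t *\<^sub>R u) - f (x + t *\<^sub>R v) + f x) / t\<^sup>2) (D v) < e"
    if t: "0 < t" "t < min d r / M" for t
  proof -
    have tM: "t * M < d" "t * M < r"
      using t M by (auto simp: field_simps)
    have inS: "x + s *\<^sub>R u + s' *\<^sub>R v \<in> S" if "0 \<le> s" "s \<le> t" "0 \<le> s'" "s' \<le> t" for s s'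
    proof -
      have "dist x (x + s *\<^sub>R u + s' *\<^sub>R v) = norm (s *\<^sub>R u + s' *\<^sub>R v)"
        by (metis add.assoc add_diff_cancel_left' dist_commute dist_norm)
      then show ?thesis
        using near[OF that] tM r by (auto simp: subset_iff)
    qed
    have der: "((\<lambda>s. f (x + s *\<^sub>R u + c *\<^sub>R v)) has_real_derivative f' (x + s *\<^sub>R u + c *\<^sub>R v) u) (at s)"
      if "0 \<le> s" "s \<le> t" "0 \<le> c" "c \<le> t" for s c
    proof -
      have F: "(f has_derivative f' (x + s *\<^sub>R u + c *\<^sub>R v)) (at (x + s *\<^sub>R u + c *\<^sub>R v))"
        using f inS that by blast
      have "((\<lambda>s. x + s *\<^sub>R u + c *\<^sub>R v) has_derivative (\<lambda>h. h *\<^sub>R u)) (at s)"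
        by (auto intro!: derivative_eq_intros)
      from has_derivative_compose[OF this F]
      have "((\<lambda>s. f (x + s *\<^sub>R u + c *\<^sub>R v)) has_derivative (\<lambda>h. f' (x + s *\<^sub>R u + c *\<^sub>R v) (h *\<^sub>R u))) (at s)" .
      moreover have "f' (x + s *\<^sub>R u + c *\<^sub>R v) (h *\<^sub>R u) = f' (x + s *\<^sub>R u + c *\<^sub>R v) u * h" for h
        using linear_scale[OF has_derivative_linear[OF F]] by simp
      ultimately show ?thesis
        by (simp add: has_field_derivative_def)
    qed
    \<comment> \<open>Mean value theorem on \<open>[0, t]\<close>: the increment of \<open>f\<close>
      by \<open>t *\<^sub>R v\<close> is regarded as a function of the displacement along
      \<open>u\<close>.\<close>
    obtain s where s: "0 < s" "s < t"
      and eq: "f (x + t *\<^sub>R u + t *\<^sub>R v) - f (x + t *\<^sub>R u) - (f (x + t *\<^sub>R v) - f x)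
        = t * (f' (x + s *\<^sub>R u + t *\<^sub>R v) u - f' (x + s *\<^sub>R u) u)"
    proof -
      have "((\<lambda>s. f (x + s *\<^sub>R u + t *\<^sub>R v) - f (x + s *\<^sub>R u)) has_real_derivative
               f' (x + s *\<^sub>R u + t *\<^sub>R v) u - f' (x + s *\<^sub>R u) u) (at s)" if "0 \<le> s" "s \<le> t" for s
        using DERIV_diff[OF der[of s t] der[of s 0]] that t by simp
      from MVT2[OF t(1) this] show ?thesis
        using that by auto
    qed
    \<comment> \<open>\<open>R\<close> is the error of the linear approximation of
      \<open>f' y u\<close> at \<open>x\<close>. Between the displacements \<open>t\<close> and 0
      along \<open>v\<close> the contributions \<open>s * D u\<close> cancel, and
      \<open>t * D v\<close> is left.\<close>
    define R where "R y = f' y u - f' x u - D (y - x)" for y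
    have R: "\<bar>R (x + s *\<^sub>R u + c *\<^sub>R v)\<bar> \<le> \<epsilon> * (t * M)" if "0 \<le> c" "c \<le> t" for c
    proof -
      have "norm (s *\<^sub>R u + c *\<^sub>R v) \<le> t * M"
        using near s that by simp
      then have "\<epsilon> * norm (s *\<^sub>R u + c *\<^sub>R v) \<le> \<epsilon> * (t * M)" "norm (s *\<^sub>R u + c *\<^sub>R v) < d"
        using \<open>\<epsilon> > 0\<close> tM by auto
      then show ?thesis
        using d(2)[of "x + s *\<^sub>R u + c *\<^sub>R v"]
        by (auto simp: R_def add.assoc intro: order_trans)
    qed
    have "f' (x + s *\<^sub>R u + t *\<^sub>R v) u - f' (x + s *\<^sub>R u) u - t * D v
          = R (x + s *\<^sub>R u + t *\<^sub>R v) - R (x + s *\<^sub>R u + 0 *\<^sub>R v)"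
      by (simp add: R_def add.assoc D.add D.scaleR)
    then have "\<bar>f' (x + s *\<^sub>R u + t *\<^sub>R v) u - f' (x + s *\<^sub>R u) u - t * D v\<bar> \<le> 2 * \<epsilon> * (t * M)"
      using R[of t] R[of 0] t by simp
    also have "\<dots> < t * e"
      using M t e by (simp add: \<epsilon>_def)
    finally have "\<bar>f' (x + s *\<^sub>R u + t *\<^sub>R v) u - f' (x + s *\<^sub>R u) u - t * D v\<bar> / t < e"
      using t by (simp add: field_simps)
    moreover have "(f (x + t *\<^sub>R u + t *\<^sub>R v) - f (x + t *\<^sub>R u) - f (x + t *\<^sub>R v) + f x) / t\<^sup>2 - D v
       = (f' (x + s *\<^sub>R u + t *\<^sub>R v) u - f' (x + s *\<^sub>R u) u - t * D v) / t"
    proof -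
      have "f (x + t *\<^sub>R u + t *\<^sub>R v) - f (x + t *\<^sub>R u) - f (x + t *\<^sub>R v) + f x
        = t * (f' (x + s *\<^sub>R u + t *\<^sub>R v) u - f' (x + s *\<^sub>R u) u)"
        using eq by simp
      then show ?thesis
        using t by (simp only:) (simp add: field_simps power2_eq_square)
    qed
    ultimately show ?thesis
      using t by (simp add: dist_real_def)
  qed
  have "min d r / M > 0"
    using d r M by simp
  with main show "\<forall>\<^sub>F t in at_right 0.
      dist ((f (x + t *\<^sub>R u + t *\<^sub>R v) - f (x + t *\<^sub>R u) - f (x + t *\<^sub>R v) + f x) / t\<^sup>2) (D v) < e"
    unfolding eventually_at_right_field by blast
qed

section \<open>Rules for coordinate derivatives\<close>

lemma pd_eqI: "(f has_derivative D) (at x) \<Longrightarrow> pd i f x = D (axis i 1)"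
  by (metis frechet_derivative_at pd_def)

lemma pd_bounded_linear:
  assumes "bounded_linear L" "f differentiable at x"
  shows "pd i (\<lambda>y. L (f y)) x = L (pd i f x)"
  using bounded_linear.has_derivative[OF assms(1) assms(2)[unfolded frechet_derivative_works]]
  by (subst pd_eqI) (auto simp: pd_def)

lemma pd_bounded_bilinear:
  assumes "bounded_bilinear B" "f differentiable at x" "h differentiable at x"
  shows "pd i (\<lambda>y. B (f y) (h y)) x = B (f x) (pd i h x) + B (pd i f x) (h x)"
  by (subst pd_eqI[OF bounded_bilinear.FDERIV[OF assms(1) assms(2,3)[unfolded frechet_derivative_works]]])
    (simp add: pd_def)

text \<open>\<open>frechet_derivative\<close> selects a derivative by choice, so functions with the
  same derivatives at \<open>x\<close> have equal \<open>pd\<close>, whether or not they are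
  differentiable there.\<close>

lemma pd_cong_open:
  assumes "open S" "x \<in> S" "\<And>y. y \<in> S \<Longrightarrow> f y = h y"
  shows "pd i f x = pd i h x"
proof -
  have "(f has_derivative D) (at x) \<longleftrightarrow> (h has_derivative D) (at x)" for D
    using has_derivative_transform_within_open[OF _ assms(1,2)] assms(3) by metis
  then show ?thesis
    by (simp add: pd_def frechet_derivative_def)
qed

lemma differentiable_cong_open:
  assumes "f differentiable at x" "open S" "x \<in> S" "\<And>y. y \<in> S \<Longrightarrow> f y = h y"
  shows "h differentiable at x"
  using assms has_derivative_transform_within_open unfolding differentiable_def by metis

text \<open>Pairing with a fixed vector \<open>w\<close> reduces the claim to real functions. There
  a single symmetric second difference tends to both mixed derivatives, and limits are
  unique.\<close>

lemma pd_commute: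
  fixes f :: "real^4 \<Rightarrow> 'b::real_inner"
  assumes S: "open S" "x \<in> S" and f: "\<And>y. y \<in> S \<Longrightarrow> f differentiable at y"
    and pd: "pd i f differentiable at x" "pd j f differentiable at x"
  shows "pd i (pd j f) x = pd j (pd i f) x"
proof -
  have lim: "((\<lambda>t. (f (x + t *\<^sub>R axis a 1 + t *\<^sub>R axis b 1) \<bullet> w - f (x + t *\<^sub>R axis a 1) \<bullet> w
      - f (x + t *\<^sub>R axis b 1) \<bullet> w + f x \<bullet> w) / t\<^sup>2) \<longlongrightarrow> pd b (pd a f) x \<bullet> w) (at_right 0)"
    if "pd a f differentiable at x" for a b w
  proof -
    have 1: "((\<lambda>y. f y \<bullet> w) has_derivative (\<lambda>h. frechet_derivative f (at y) h \<bullet> w)) (at y)" if "y \<in> S" for y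
      using f[OF that] by (intro bounded_linear.has_derivative[OF bounded_linear_inner_left])
        (simp add: frechet_derivative_works)
    have 2: "((\<lambda>y. frechet_derivative f (at y) (axis a 1) \<bullet> w) has_derivative
        (\<lambda>h. frechet_derivative (pd a f) (at x) h \<bullet> w)) (at x)"
      using that unfolding frechet_derivative_works pd_def
      by (intro bounded_linear.has_derivative[OF bounded_linear_inner_left])
    show ?thesis
      using second_difference_limit[OF S 1 2, of "axis b 1"] by (simp add: pd_def)
  qed
  have "pd i (pd j f) x \<bullet> w = pd j (pd i f) x \<bullet> w" for w
  proof (rule tendsto_unique[OF _ lim[OF pd(2), of i w]])
    show "((\<lambda>t. (f (x + t *\<^sub>R axis j 1 + t *\<^sub>R axis i 1) \<bullet> w - f (x + t *\<^sub>R axis j 1) \<bullet> w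
      - f (x + t *\<^sub>R axis i 1) \<bullet> w + f x \<bullet> w) / t\<^sup>2) \<longlongrightarrow> pd j (pd i f) x \<bullet> w) (at_right 0)"
      using lim[OF pd(1), of j w] by (simp add: algebra_simps)
  qed simp
  then show ?thesis
    using vector_eq_rdot by blast
qed

lemma pd_const: "pd i (\<lambda>y. c) x = 0"
  by (simp add: pd_eqI[OF has_derivative_const])

lemma pd_add:
  assumes "f differentiable at x" "h differentiable at x"
  shows "pd i (\<lambda>y. f y + h y) x = pd i f x + pd i h x"
  by (subst pd_eqI[OF has_derivative_add[OF assms[unfolded frechet_derivative_works]]])
    (simp add: pd_def)

lemma pd_diff:
  assumes "f differentiable at x" "h differentiable at x"
  shows "pd i (\<lambda>y. f y - h y) x = pd i f x - pd i h x"
  by (subst pd_eqI[OF has_derivative_diff[OF assms[unfolded frechet_derivative_works]]])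
    (simp add: pd_def)

lemma bounded_linear_differentiable:
  "bounded_linear L \<Longrightarrow> f differentiable at x \<Longrightarrow> (\<lambda>y. L (f y)) differentiable at x"
  unfolding differentiable_def using bounded_linear.has_derivative by blast

lemma bounded_bilinear_differentiable:
  "bounded_bilinear B \<Longrightarrow> f differentiable at x \<Longrightarrow> h differentiable at x \<Longrightarrow>
   (\<lambda>y. B (f y) (h y)) differentiable at x"
  unfolding differentiable_def using bounded_bilinear.FDERIV by blast

lemma differentiable_prod:
  fixes f :: "'i \<Rightarrow> 'a::real_normed_vector \<Rightarrow> 'b::real_normed_field"
  assumes "finite I" "\<And>i. i \<in> I \<Longrightarrow> f i differentiable at x"
  shows "(\<lambda>y. \<Prod>i\<in>I. f i y) differentiable at x"
  using assms by (induction I rule: finite_induct) (auto intro!: differentiable_mult)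

section \<open>Differentiability of matrix-valued functions and of the matrix inverse\<close>

lemma bounded_linear_entry: "bounded_linear (\<lambda>M :: real^'n^'m. M $ i $ j)"
  using bounded_linear_compose[OF bounded_linear_vec_nth bounded_linear_vec_nth] .

lemma bounded_bilinear_matrix_mult:
  "bounded_bilinear ((**) :: real^'m^'n \<Rightarrow> real^'k^'m \<Rightarrow> real^'k^'n)"
  unfolding bilinear_conv_bounded_bilinear[symmetric] bilinear_def linear_iff
  by (auto simp: vec_eq_iff matrix_matrix_mult_def algebra_simps sum.distrib sum_distrib_left)

interpretation matrix_mult: bounded_bilinear "(**) :: real^'m^'n \<Rightarrow> real^'k^'m \<Rightarrow> real^'k^'n"
  by (rule bounded_bilinear_matrix_mult)

lemma bounded_linear_transpose: "bounded_linear (transpose :: real^'n^'m \<Rightarrow> real^'m^'n)"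
  by (simp add: linear_conv_bounded_linear[symmetric] linear_iff transpose_def vec_eq_iff)

text \<open>Expansion in elementary matrices, through which regularity of the entries passes to the
  matrix.\<close>

lemma matrix_eq_sum_entries:
  fixes M :: "real^'n^'m"
  shows "M = (\<Sum>i\<in>UNIV. \<Sum>j\<in>UNIV. (M $ i $ j) *\<^sub>R axis i (axis j 1))"
proof -
  have "(\<Sum>j\<in>UNIV. (M $ i $ j) *\<^sub>R axis i (axis j 1)) = (axis i (M $ i) :: real^'n^'m)" for i
    by (auto simp: vec_eq_iff axis_def if_distrib cong: if_cong)
  then show ?thesis
    by (simp add: vec_eq_iff axis_def if_distrib[of "\<lambda>v. v $ _"] cong: if_cong)
qed

lemma differentiable_matrixI:
  fixes f :: "'a::real_normed_vector \<Rightarrow> real^'n^'m"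
  assumes "\<And>i j. (\<lambda>y. f y $ i $ j) differentiable at x"
  shows "f differentiable at x"
proof -
  have "(\<lambda>y. \<Sum>i\<in>UNIV. \<Sum>j\<in>UNIV. (f y $ i $ j) *\<^sub>R (axis i (axis j 1) :: real^'n^'m)) differentiable at x"
    using assms by (intro differentiable_sum ballI
        bounded_linear_differentiable[OF bounded_linear_scaleR_left]) auto
  then show ?thesis
    by (simp flip: matrix_eq_sum_entries)
qed

lemma differentiable_det:
  fixes M :: "'a::real_normed_vector \<Rightarrow> real^'n^'n"
  assumes "\<And>i j. (\<lambda>y. M y $ i $ j) differentiable at x"
  shows "(\<lambda>y. det (M y)) differentiable at x"
  unfolding det_def using assms
  by (intro differentiable_sum ballI differentiable_mult differentiable_prod) auto

lemma matrix_inv_mult: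
  fixes A :: "'a::field^'n^'n"
  assumes "invertible A"
  shows "A ** matrix_inv A = mat 1" "matrix_inv A ** A = mat 1"
  using someI_ex[OF assms[unfolded invertible_def]] unfolding matrix_inv_def by auto

text \<open>Column \<open>l\<close> of the inverse solves \<open>A *v y = axis l 1\<close>, so
  Cramer's rule applies. It makes the entries quotients of determinants, from which
  differentiability can be read off.\<close>

lemma matrix_inv_cramer:
  fixes A :: "'a::field^'n^'n"
  assumes "invertible A"
  shows "matrix_inv A $ k $ l = det (\<chi> i j. if j = k then axis l 1 $ i else A $ i $ j) / det A"
proof -
  have "A *v column l (matrix_inv A) = axis l 1"
    using arg_cong[OF matrix_inv_mult(1)[OF assms], of "column l"]
    by (simp add: vec_eq_iff column_def matrix_matrix_mult_def matrix_vector_mult_def mat_def axis_def)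
  then have "column l (matrix_inv A)
      = (\<chi> k. det (\<chi> i j. if j = k then axis l 1 $ i else A $ i $ j) / det A)"
    using cramer assms invertible_det_nz by blast
  from arg_cong[OF this, of "\<lambda>v. v $ k"] show ?thesis
    by (simp add: column_def)
qed

lemma differentiable_matrix_inv:
  fixes M :: "'a::real_normed_vector \<Rightarrow> real^'n^'n"
  assumes S: "open S" "x \<in> S" and M: "M differentiable at x" "\<And>y. y \<in> S \<Longrightarrow> invertible (M y)"
  shows "(\<lambda>y. matrix_inv (M y)) differentiable at x"
proof (rule differentiable_matrixI)
  fix k l
  have entry: "(\<lambda>y. M y $ i $ j) differentiable at x" for i j
    using bounded_linear_differentiable[OF bounded_linear_entry M(1)] .
  have "(\<lambda>y. (if j = k then axis l 1 $ i else M y $ i $ j)) differentiable at x" for i j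
    using entry by (cases "j = k") auto
  then have "(\<lambda>y. det (\<chi> i j. if j = k then axis l 1 $ i else M y $ i $ j)) differentiable at x"
    by (intro differentiable_det) simp
  moreover have "(\<lambda>y. det (M y)) differentiable at x"
    using entry by (rule differentiable_det)
  moreover have "det (M x) \<noteq> 0"
    using M(2) S invertible_det_nz by blast
  ultimately have "(\<lambda>y. det (\<chi> i j. if j = k then axis l 1 $ i else M y $ i $ j) / det (M y))
      differentiable at x"
    by (intro differentiable_divide)
  then show "(\<lambda>y. matrix_inv (M y) $ k $ l) differentiable at x"
    by (rule differentiable_cong_open[OF _ S]) (simp add: matrix_inv_cramer M(2))
qed

text \<open>Two orders are the regularity of the Christoffel symbols that the second Bianchi
  identity uses. Unlike \<open>smooth_on\<close>, closure under products and inverses takes only the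
  first-order formulas for their derivatives.\<close>

definition twice_differentiable_on :: "(real^4) set \<Rightarrow> (real^4 \<Rightarrow> 'b::real_normed_vector) \<Rightarrow> bool" where
  "twice_differentiable_on S f \<longleftrightarrow>
     (\<forall>x\<in>S. f differentiable at x \<and> (\<forall>i. pd i f differentiable at x))"

lemma twice_differentiable_onD:
  assumes "twice_differentiable_on S f" "x \<in> S"
  shows "f differentiable at x" "pd i f differentiable at x"
  using assms by (auto simp: twice_differentiable_on_def)

text \<open>A formula \<open>f'\<close> for the partial derivatives is enough: \<open>S\<close> is
  open, so agreement on \<open>S\<close> transfers differentiability from \<open>f' i\<close> to
  \<open>pd i f\<close>.\<close>

lemma twice_differentiable_onI:
  assumes "open S" "\<And>x. x \<in> S \<Longrightarrow> f differentiable at x"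
    and "\<And>x i. x \<in> S \<Longrightarrow> pd i f x = f' i x" "\<And>x i. x \<in> S \<Longrightarrow> f' i differentiable at x"
  shows "twice_differentiable_on S f"
  unfolding twice_differentiable_on_def
  using assms by (metis differentiable_cong_open[of "f' _" _ S "pd _ f"])

lemma smooth_on_pd: "smooth_on S f \<Longrightarrow> smooth_on S (pd i f)"
  unfolding smooth_on_def
proof
  fix "is"
  assume "\<forall>is. foldr pd is f differentiable_on S"
  \<comment> \<open>\<open>foldr\<close> applies the last list element first, so the derivative that
    is taken before all others is appended.\<close>
  then have "foldr pd (is @ [i]) f differentiable_on S" ..
  then show "foldr pd is (pd i f) differentiable_on S"
    by simp
qed

lemma smooth_on_differentiable: "open S \<Longrightarrow> smooth_on S f \<Longrightarrow> x \<in> S \<Longrightarrow> f differentiable at x"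
  using differentiable_on_eq_differentiable_at[of S f] by (auto simp: smooth_on_def dest: spec[of _ "[]"])

lemma smooth_on_twice_differentiable: "open S \<Longrightarrow> smooth_on S f \<Longrightarrow> twice_differentiable_on S f"
  by (simp add: smooth_on_differentiable smooth_on_pd twice_differentiable_on_def)

lemma twice_differentiable_on_const: "open S \<Longrightarrow> twice_differentiable_on S (\<lambda>y. c)"
  by (rule twice_differentiable_onI[where f' = "\<lambda>i y. 0"]) (auto simp: pd_const)

lemma twice_differentiable_on_add:
  assumes "open S" "twice_differentiable_on S f" "twice_differentiable_on S h"
  shows "twice_differentiable_on S (\<lambda>y. f y + h y)"
  using assms(1) by (rule twice_differentiable_onI[where f' = "\<lambda>i y. pd i f y + pd i h y"])
    (use assms in \<open>auto simp: twice_differentiable_on_def intro!: differentiable_add pd_add\<close>)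

lemma twice_differentiable_on_bounded_linear:
  assumes "open S" "bounded_linear L" "twice_differentiable_on S f"
  shows "twice_differentiable_on S (\<lambda>y. L (f y))"
  using assms(1) by (rule twice_differentiable_onI[where f' = "\<lambda>i y. L (pd i f y)"])
    (use assms in \<open>auto simp: twice_differentiable_on_def
      intro!: bounded_linear_differentiable[OF assms(2)] pd_bounded_linear\<close>)

lemma twice_differentiable_on_bounded_bilinear:
  assumes "open S" "bounded_bilinear B" "twice_differentiable_on S f" "twice_differentiable_on S h"
  shows "twice_differentiable_on S (\<lambda>y. B (f y) (h y))"
  using assms(1) by (rule twice_differentiable_onI[where f' = "\<lambda>i y. B (f y) (pd i h y) + B (pd i f y) (h y)"])
    (use assms in \<open>auto simp: twice_differentiable_on_def
      intro!: bounded_bilinear_differentiable[OF assms(2)] differentiable_add pd_bounded_bilinear\<close>)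

lemma twice_differentiable_on_diff:
  assumes "open S" "twice_differentiable_on S f" "twice_differentiable_on S h"
  shows "twice_differentiable_on S (\<lambda>y. f y - h y)"
  using assms(1) by (rule twice_differentiable_onI[where f' = "\<lambda>i y. pd i f y - pd i h y"])
    (use assms in \<open>auto simp: twice_differentiable_on_def intro!: differentiable_diff pd_diff\<close>)

lemma twice_differentiable_on_sum:
  assumes "open S" "finite I" "\<And>i. i \<in> I \<Longrightarrow> twice_differentiable_on S (f i)"
  shows "twice_differentiable_on S (\<lambda>y. \<Sum>i\<in>I. f i y)"
  using assms(2,3)
  by (induction I rule: finite_induct)
    (simp_all add: twice_differentiable_on_const twice_differentiable_on_add assms(1))

lemma twice_differentiable_on_matrixI:
  fixes f :: "real^4 \<Rightarrow> real^'n^'m"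
  assumes "open S" "\<And>i j. twice_differentiable_on S (\<lambda>y. f y $ i $ j)"
  shows "twice_differentiable_on S f"
proof -
  have "twice_differentiable_on S
      (\<lambda>y. \<Sum>i\<in>UNIV. \<Sum>j\<in>UNIV. (f y $ i $ j) *\<^sub>R (axis i (axis j 1) :: real^'n^'m))"
    using assms by (intro twice_differentiable_on_sum
        twice_differentiable_on_bounded_linear[OF _ bounded_linear_scaleR_left]) auto
  then show ?thesis
    by (simp flip: matrix_eq_sum_entries)
qed

text \<open>Differentiating \<open>M y ** matrix_inv (M y) = mat 1\<close> expresses the derivative
  of the inverse through the inverse and \<open>pd i M\<close>, and both of these are
  differentiable.\<close>

lemma twice_differentiable_on_matrix_inv:
  fixes M :: "real^4 \<Rightarrow> real^'n^'n"
  assumes S: "open S" and M: "twice_differentiable_on S M" "\<And>y. y \<in> S \<Longrightarrow> invertible (M y)"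
  shows "twice_differentiable_on S (\<lambda>y. matrix_inv (M y))"
proof -
  have D: "(\<lambda>y. matrix_inv (M y)) differentiable at x" if "x \<in> S" for x
    using differentiable_matrix_inv[OF S that twice_differentiable_onD(1)[OF M(1) that] M(2)] .
  show ?thesis
  proof (rule twice_differentiable_onI[OF S D])
    fix x i assume x: "x \<in> S"
    let ?H = "matrix_inv (M x)"
    have "M x ** pd i (\<lambda>y. matrix_inv (M y)) x + pd i M x ** ?H = pd i (\<lambda>y. M y ** matrix_inv (M y)) x"
      using pd_bounded_bilinear[OF bounded_bilinear_matrix_mult
          twice_differentiable_onD(1)[OF M(1) x] D[OF x]] by simp
    also have "\<dots> = pd i (\<lambda>y. mat 1 :: real^'n^'n) x"
      by (rule pd_cong_open[OF S x]) (simp add: matrix_inv_mult M(2))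
    finally have "?H ** (M x ** pd i (\<lambda>y. matrix_inv (M y)) x + pd i M x ** ?H) = 0"
      by (simp add: pd_const)
    then show "pd i (\<lambda>y. matrix_inv (M y)) x = - (?H ** (pd i M x ** ?H))"
      by (simp add: matrix_mult.add_right matrix_mul_assoc matrix_inv_mult M(2) x eq_neg_iff_add_eq_0)
  next
    fix x i assume "x \<in> S"
    then show "(\<lambda>x. - (matrix_inv (M x) ** (pd i M x ** matrix_inv (M x)))) differentiable at x"
      using D M(1)
      by (intro differentiable_minus bounded_bilinear_differentiable[OF bounded_bilinear_matrix_mult])
        (auto dest: twice_differentiable_onD)
  qed
qed

section \<open>Curvature matrices\<close>

definition connection_matrix :: "(real^4 \<Rightarrow> real^4^4) \<Rightarrow> 4 \<Rightarrow> real^4 \<Rightarrow> real^4^4" where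
  "connection_matrix g a y = (\<chi> k c. christoffel g y k a c)"

definition curvature_matrix :: "(4 \<Rightarrow> real^4 \<Rightarrow> real^4^4) \<Rightarrow> 4 \<Rightarrow> 4 \<Rightarrow> real^4 \<Rightarrow> real^4^4" where
  "curvature_matrix \<Gamma> a b y =
     pd a (\<Gamma> b) y - pd b (\<Gamma> a) y + \<Gamma> a y ** \<Gamma> b y - \<Gamma> b y ** \<Gamma> a y"

text \<open>The covariant derivative of the curvature as an endomorphism: the commutator with
  \<open>\<Gamma> e\<close> acts on the two matrix indices, while \<open>a\<close> and
  \<open>b\<close> receive no Christoffel terms. This is the form suited to the cyclic sum in the
  Bianchi identity.\<close>

definition cov_deriv_curvature :: "(4 \<Rightarrow> real^4 \<Rightarrow> real^4^4) \<Rightarrow> 4 \<Rightarrow> 4 \<Rightarrow> 4 \<Rightarrow> real^4 \<Rightarrow> real^4^4" where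
  "cov_deriv_curvature \<Gamma> e a b x = pd e (curvature_matrix \<Gamma> a b) x
     + \<Gamma> e x ** curvature_matrix \<Gamma> a b x - curvature_matrix \<Gamma> a b x ** \<Gamma> e x"

lemma curvature_matrix_differentiable:
  assumes "x \<in> S" "\<And>a. twice_differentiable_on S (\<Gamma> a)"
  shows "curvature_matrix \<Gamma> a b differentiable at x"
  using twice_differentiable_onD[OF assms(2,1)] unfolding curvature_matrix_def[abs_def]
  by (intro differentiable_add differentiable_diff bounded_bilinear_differentiable[OF bounded_bilinear_matrix_mult])

lemma pd_curvature_matrix:
  assumes "x \<in> S" "\<And>a. twice_differentiable_on S (\<Gamma> a)"
  shows "pd e (curvature_matrix \<Gamma> a b) x = pd e (pd a (\<Gamma> b)) x - pd e (pd b (\<Gamma> a)) x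
     + (\<Gamma> a x ** pd e (\<Gamma> b) x + pd e (\<Gamma> a) x ** \<Gamma> b x)
     - (\<Gamma> b x ** pd e (\<Gamma> a) x + pd e (\<Gamma> b) x ** \<Gamma> a x)"
proof -
  note D = twice_differentiable_onD[OF assms(2,1)]
  note D2 = D differentiable_add[OF differentiable_diff[OF D(2) D(2)]
      bounded_bilinear_differentiable[OF bounded_bilinear_matrix_mult D(1) D(1)]]
    differentiable_diff[OF D(2) D(2)] bounded_bilinear_differentiable[OF bounded_bilinear_matrix_mult D(1) D(1)]
  show ?thesis
    unfolding curvature_matrix_def[abs_def]
    by (simp only: pd_diff[OF D2(3,5)] pd_add[OF D2(4,5)] pd_diff[OF D(2) D(2)]
        pd_bounded_bilinear[OF bounded_bilinear_matrix_mult D(1) D(1)])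
qed

text \<open>In the cyclic sum the second derivatives cancel because partial derivatives commute; the
  remaining quadratic and cubic terms cancel by associativity of the matrix product.\<close>

lemma second_bianchi_identity:
  assumes "open S" "x \<in> S" "\<And>a. twice_differentiable_on S (\<Gamma> a)"
  shows "cov_deriv_curvature \<Gamma> e a b x + cov_deriv_curvature \<Gamma> a b e x
    + cov_deriv_curvature \<Gamma> b e a x = 0"
proof -
  have comm: "pd i (pd j (\<Gamma> c)) x = pd j (pd i (\<Gamma> c)) x" for i j c
    using twice_differentiable_onD[OF assms(3)] assms by (intro pd_commute[OF assms(1,2)]) auto
  show ?thesis
    unfolding cov_deriv_curvature_def pd_curvature_matrix[OF assms(2,3)] curvature_matrix_def
      matrix_mult.add_left matrix_mult.add_right matrix_mult.diff_left matrix_mult.diff_right matrix_mul_assoc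
    by (simp add: algebra_simps comm[of a e] comm[of b a] comm[of b e])
qed

lemma nabla_coord_field:
  "nabla g (coord_field a) Y x = pd a Y x + connection_matrix g a x *v Y x"
  by (simp add: vec_eq_iff nabla_def coord_field_def connection_matrix_def matrix_vector_mult_def
      axis_def if_distrib[of "\<lambda>u. u * _"] cong: if_cong)

lemma bounded_linear_column: "bounded_linear (column c :: real^'n^'m \<Rightarrow> real^'m)"
  by (simp add: linear_conv_bounded_linear[symmetric] linear_iff column_def vec_eq_iff)

text \<open>The derivative of the coordinate field \<open>c\<close> along \<open>b\<close> is column
  \<open>c\<close> of the connection matrix, so a second derivative along \<open>a\<close> produces
  column \<open>c\<close> of the derivative plus the product of connection matrices. The bracket
  term vanishes since coordinate fields commute.\<close>

lemma riemann_eq_curvature_matrix: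
  assumes "\<And>a. connection_matrix g a differentiable at x"
  shows "riemann g x a b c d = (transpose (curvature_matrix (connection_matrix g) a b x) ** g x) $ c $ d"
proof -
  have 1: "nabla g (coord_field a) (coord_field c) = (\<lambda>y. column c (connection_matrix g a y))" for a
    unfolding nabla_coord_field
    by (simp add: coord_field_def pd_const fun_eq_iff matrix_vector_mul_component matrix_vector_mult_basis)
  have 2: "nabla g (coord_field a) (nabla g (coord_field b) (coord_field c)) x
      = column c (pd a (connection_matrix g b) x + connection_matrix g a x ** connection_matrix g b x)" for a b
    unfolding 1 unfolding nabla_coord_field pd_bounded_linear[OF bounded_linear_column assms]
    by (simp add: vec_eq_iff column_def matrix_vector_mult_def matrix_matrix_mult_def)
  have "lie_bracket (coord_field a) (coord_field b) = (\<lambda>x. 0)"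
    by (simp add: fun_eq_iff vec_eq_iff lie_bracket_def coord_field_def pd_const)
  then have 3: "nabla g (lie_bracket (coord_field a) (coord_field b)) (coord_field c) x = 0"
    by (simp add: nabla_def vec_eq_iff)
  have "riemann_op g (coord_field a) (coord_field b) (coord_field c) x
      = column c (curvature_matrix (connection_matrix g) a b x)"
    unfolding riemann_op_def 2 3 by (simp add: curvature_matrix_def vec_eq_iff column_def)
  then show ?thesis
    unfolding riemann_def coord_field_def matrix_vector_mult_basis
    by (simp add: inner_vec_def column_def transpose_def matrix_matrix_mult_def)
qed

section \<open>Metric, connection and curvature in a single chart\<close>

locale lorentzian_chart =
  fixes g :: "real^4 \<Rightarrow> real^4^4" and S :: "(real^4) set"
  assumes open_S: "open S" and smooth: "smooth_on S g"
    and lorentzian: "y \<in> S \<Longrightarrow> lorentzian_form (g y)"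
begin

abbreviation \<Gamma> where "\<Gamma> \<equiv> connection_matrix g"

abbreviation F where "F \<equiv> curvature_matrix \<Gamma>"

lemma g_sym: "y \<in> S \<Longrightarrow> transpose (g y) = g y"
  using lorentzian lorentzian_form_symmetric by blast

lemma g_sym_entry: "y \<in> S \<Longrightarrow> g y $ i $ j = g y $ j $ i"
  using arg_cong[OF g_sym, of y "\<lambda>G. G $ j $ i"] by (simp add: transpose_def)

lemma g_invertible: "y \<in> S \<Longrightarrow> invertible (g y)"
  using lorentzian lorentzian_form_invertible by blast

lemma g_twice_differentiable: "twice_differentiable_on S g" "twice_differentiable_on S (pd i g)"
  by (rule smooth_on_twice_differentiable[OF open_S smooth],
      rule smooth_on_twice_differentiable[OF open_S smooth_on_pd[OF smooth]])

lemma \<Gamma>_twice_differentiable: "twice_differentiable_on S (\<Gamma> a)"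
proof (rule twice_differentiable_on_matrixI[OF open_S])
  fix k c
  have H: "twice_differentiable_on S (\<lambda>y. matrix_inv (g y) $ i $ j)" for i j
    using twice_differentiable_on_matrix_inv[OF open_S g_twice_differentiable(1) g_invertible]
    by (rule twice_differentiable_on_bounded_linear[OF open_S bounded_linear_entry])
  have P: "twice_differentiable_on S (\<lambda>y. pd l g y $ i $ j)" for i j l
    using g_twice_differentiable(2)
    by (rule twice_differentiable_on_bounded_linear[OF open_S bounded_linear_entry])
  show "twice_differentiable_on S (\<lambda>y. \<Gamma> a y $ k $ c)"
    unfolding connection_matrix_def christoffel_def vec_lambda_beta
    by (intro twice_differentiable_on_bounded_linear[OF open_S bounded_linear_mult_right]
        twice_differentiable_on_sum twice_differentiable_on_bounded_bilinear[OF open_S bounded_bilinear_mult]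
        twice_differentiable_on_add twice_differentiable_on_diff H P open_S finite)
qed

lemma \<Gamma>_differentiable: "x \<in> S \<Longrightarrow> \<Gamma> a differentiable at x"
  using \<Gamma>_twice_differentiable twice_differentiable_onD(1) by blast

lemma \<Gamma>_sym:
  assumes "x \<in> S"
  shows "\<Gamma> a x $ k $ b = \<Gamma> b x $ k $ a"
proof -
  have "g differentiable_on S"
    using smooth by (auto simp: smooth_on_def dest: spec[of _ "[]"])
  note sym = pd_metric_sym[OF open_S assms this lorentzian]
  show ?thesis
    unfolding connection_matrix_def christoffel_def vec_lambda_beta
    by (intro arg_cong[of _ _ "\<lambda>s. 1/2 * s"] sum.cong refl) (metis sym add.commute)
qed

text \<open>Metric compatibility from \<open>nabla_metric\<close> in matrix form, ready for the
  product rule for matrices.\<close>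

lemma pd_metric:
  assumes "x \<in> S"
  shows "pd a g x = transpose (\<Gamma> a x) ** g x + g x ** \<Gamma> a x"
proof -
  have "g differentiable_on S"
    using smooth by (auto simp: smooth_on_def dest: spec[of _ "[]"])
  note metric = nabla_metric[OF open_S assms this lorentzian]
  show ?thesis
    by (simp add: metric vec_eq_iff connection_matrix_def transpose_def matrix_matrix_mult_def mult.commute)
qed

text \<open>Differentiating \<open>pd_metric\<close> once more gives the second derivatives of
  \<open>g\<close>. Commuting them leaves, up to sign, exactly this combination of the curvature
  with \<open>g\<close>.\<close>

lemma F_skew:
  assumes x: "x \<in> S"
  shows "transpose (F a b x) ** g x + g x ** F a b x = 0"
proof -
  note D = \<Gamma>_differentiable[OF x] twice_differentiable_onD(1)[OF g_twice_differentiable(1) x]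
  note DT = bounded_linear_differentiable[OF bounded_linear_transpose D(1)]
  have second: "pd b (pd a g) x = (transpose (\<Gamma> a x) ** (transpose (\<Gamma> b x) ** g x + g x ** \<Gamma> b x)
      + transpose (pd b (\<Gamma> a) x) ** g x)
      + (g x ** pd b (\<Gamma> a) x + (transpose (\<Gamma> b x) ** g x + g x ** \<Gamma> b x) ** \<Gamma> a x)" for a b
  proof -
    have "pd b (pd a g) x = pd b (\<lambda>y. transpose (\<Gamma> a y) ** g y + g y ** \<Gamma> a y) x"
      using pd_metric by (rule pd_cong_open[OF open_S x])
    also have "\<dots> = (transpose (\<Gamma> a x) ** pd b g x + transpose (pd b (\<Gamma> a) x) ** g x)
      + (g x ** pd b (\<Gamma> a) x + pd b g x ** \<Gamma> a x)"
      by (simp only: pd_add[OF bounded_bilinear_differentiable[OF bounded_bilinear_matrix_mult DT D(2)]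
            bounded_bilinear_differentiable[OF bounded_bilinear_matrix_mult D(2,1)]]
          pd_bounded_bilinear[OF bounded_bilinear_matrix_mult DT D(2)]
          pd_bounded_bilinear[OF bounded_bilinear_matrix_mult D(2,1)]
          pd_bounded_linear[OF bounded_linear_transpose D(1)])
    finally show ?thesis
      by (simp only: pd_metric[OF x])
  qed
  have "pd a (pd b g) x = pd b (pd a g) x"
    using twice_differentiable_onD[OF g_twice_differentiable(1)] x
    by (intro pd_commute[OF open_S x]) auto
  moreover have transpose_linear: "transpose (A + B) = transpose A + transpose B"
    "transpose (A - B) = transpose A - transpose B"
    for A B :: "real^4^4"
    by (simp_all add: transpose_def vec_eq_iff)
  ultimately show ?thesis
    unfolding second curvature_matrix_def transpose_linear matrix_transpose_mul
    by (simp add: matrix_mult.add_left matrix_mult.add_right matrix_mult.diff_left matrix_mult.diff_right matrix_mul_assoc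
        algebra_simps)
qed

lemma riemann_eq: "x \<in> S \<Longrightarrow> riemann g x a b c d = (transpose (F a b x) ** g x) $ c $ d"
  using \<Gamma>_differentiable by (rule riemann_eq_curvature_matrix)

text \<open>As \<open>g x\<close> is symmetric, transposing
  \<open>transpose (F a b x) ** g x\<close> gives \<open>g x ** F a b x\<close>, which is its
  negative by \<open>F_skew\<close>.\<close>

lemma riemann_skew:
  assumes "x \<in> S"
  shows "riemann g x a b d c = - riemann g x a b c d"
proof -
  have "riemann g x a b d c = transpose (transpose (F a b x) ** g x) $ c $ d"
    by (simp add: riemann_eq[OF assms] transpose_def)
  also have "\<dots> = (g x ** F a b x) $ c $ d"
    by (simp add: matrix_transpose_mul g_sym[OF assms])
  also have "g x ** F a b x = - (transpose (F a b x) ** g x)"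
    using F_skew[OF assms] by (simp add: eq_neg_iff_add_eq_0 add.commute)
  finally show ?thesis
    by (simp add: riemann_eq[OF assms])
qed

lemma inv_contract:
  assumes "x \<in> S"
  shows "(\<Sum>c\<in>UNIV. matrix_inv (g x) $ b $ c * g x $ a $ c) = (if b = a then 1 else 0)"
    and "(\<Sum>b\<in>UNIV. matrix_inv (g x) $ b $ c * g x $ b $ a) = (if c = a then 1 else 0)"
    and "(\<Sum>b\<in>UNIV. g x $ a $ b * matrix_inv (g x) $ b $ c) = (if c = a then 1 else 0)"
proof -
  note I = matrix_inv_mult[OF g_invertible[OF assms]]
  show "(\<Sum>c\<in>UNIV. matrix_inv (g x) $ b $ c * g x $ a $ c) = (if b = a then 1 else 0)"
    using arg_cong[OF I(2), of "\<lambda>M. M $ b $ a"]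
    by (subst g_sym_entry[OF assms]) (simp add: matrix_matrix_mult_def mat_def)
  show *: "(\<Sum>b\<in>UNIV. g x $ a $ b * matrix_inv (g x) $ b $ c) = (if c = a then 1 else 0)"
    using arg_cong[OF I(1), of "\<lambda>M. M $ a $ c"]
    by (auto simp add: matrix_matrix_mult_def mat_def)
  then show "(\<Sum>b\<in>UNIV. matrix_inv (g x) $ b $ c * g x $ b $ a) = (if c = a then 1 else 0)"
    using g_sym_entry[OF assms] by (simp add: mult.commute)
qed

end

section \<open>Schur's lemma for \<open>W\<close>-flat metrics\<close>

text \<open>A derivative that vanishes on the basis vectors is zero by linearity, and a ball is
  convex, so \<open>f\<close> is constant on it.\<close>

lemma pd_zero_locally_constant:
  fixes f :: "real^4 \<Rightarrow> 'b::real_normed_vector"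
  assumes S: "open S" "x \<in> S" and f: "\<And>y. y \<in> S \<Longrightarrow> f differentiable at y"
    and pd: "\<And>y i. y \<in> S \<Longrightarrow> pd i f y = 0"
  obtains r where "r > 0" "ball x r \<subseteq> S" "\<And>y. y \<in> ball x r \<Longrightarrow> f y = f x"
proof -
  obtain r where r: "r > 0" "ball x r \<subseteq> S"
    using S open_contains_ball by blast
  have "(f has_derivative (\<lambda>h. 0)) (at y within ball x r)" if "y \<in> ball x r" for y
  proof -
    have y: "y \<in> S"
      using that r by blast
    have D: "(f has_derivative frechet_derivative f (at y)) (at y)"
      using f[OF y] by (simp add: frechet_derivative_works)
    have lin: "linear (frechet_derivative f (at y))"
      using D by (rule has_derivative_linear)
    have "frechet_derivative f (at y) h = 0" for h
    proof -
      have "frechet_derivative f (at y) h = frechet_derivative f (at y) (\<Sum>i\<in>UNIV. h $ i *\<^sub>R axis i 1)"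
        by (simp add: basis_expansion flip: scalar_mult_eq_scaleR)
      also have "\<dots> = (\<Sum>i\<in>UNIV. h $ i *\<^sub>R frechet_derivative f (at y) (axis i 1))"
        by (simp add: linear_sum[OF lin] linear_scale[OF lin])
      also have "\<dots> = 0"
        using pd[OF y] by (simp add: pd_def)
      finally show ?thesis .
    qed
    then have "frechet_derivative f (at y) = (\<lambda>h. 0)" ..
    with D show ?thesis
      by (metis has_derivative_at_withinI)
  qed
  from has_derivative_zero_constant[OF convex_ball this] obtain c where "\<forall>y\<in>ball x r. f y = c"
    by blast
  with r that show ?thesis
    by simp
qed

text \<open>Putting row \<open>b\<close> of \<open>G\<close> into row \<open>a\<close> of a zero
  matrix yields the two terms of the constant-curvature form below; linearity in \<open>G\<close>
  lets them be differentiated.\<close>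

lemma bounded_linear_axis_row: "bounded_linear (\<lambda>G :: real^'n^'n. axis a (G $ b) :: real^'n^'n)"
  by (simp add: linear_conv_bounded_linear[symmetric] linear_iff vec_eq_iff axis_def)

context lorentzian_chart
begin

context
  assumes W_flat: "\<And>x a b c d. x \<in> S \<Longrightarrow> w_curv g x a b c d = 0"
begin

lemma riemann_ricci:
  "x \<in> S \<Longrightarrow> riemann g x a b c d = 1/3 * (g x $ b $ c * ricci g x a d - g x $ a $ c * ricci g x b d)"
  using W_flat[of x a b c d] by (simp add: w_curv_def field_simps)

text \<open>The skew-symmetry is contracted with the inverse metric over \<open>b\<close> and
  \<open>c\<close>. Since the trace of the metric is 4, the left side becomes five times
  \<open>ricci g x a d\<close>; the right side contributes it once, together with the scalar
  curvature times \<open>g x $ a $ d\<close>.\<close>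

lemma ricci_einstein:
  assumes x: "x \<in> S"
  shows "ricci g x a d = scalar_curv g x / 4 * g x $ a $ d"
proof -
  let ?H = "matrix_inv (g x)"
  let ?R = "ricci g x"
  have skew: "g x $ b $ c * ?R a d + g x $ b $ d * ?R a c = g x $ a $ c * ?R b d + g x $ a $ d * ?R b c" for b c
    using riemann_skew[OF x, of a b c d] unfolding riemann_ricci[OF x] by argo
  have "(\<Sum>b\<in>UNIV. \<Sum>c\<in>UNIV. ?H $ b $ c * (g x $ b $ c * ?R a d + g x $ b $ d * ?R a c))
     = 5 * ?R a d"
  proof -
    have "(\<Sum>b\<in>UNIV. \<Sum>c\<in>UNIV. ?H $ b $ c * (g x $ b $ c * ?R a d)) = 4 * ?R a d"
      by (simp add: inv_contract(1)[OF x] flip: mult.assoc sum_distrib_right)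
    moreover have "(\<Sum>b\<in>UNIV. \<Sum>c\<in>UNIV. ?H $ b $ c * (g x $ b $ d * ?R a c)) = ?R a d"
      by (subst sum.swap) (simp add: inv_contract(2)[OF x] if_distrib[of "\<lambda>u. u * _"] cong: if_cong
          flip: mult.assoc sum_distrib_right)
    ultimately show ?thesis
      by (simp add: distrib_left sum.distrib)
  qed
  moreover have "(\<Sum>b\<in>UNIV. \<Sum>c\<in>UNIV. ?H $ b $ c * (g x $ a $ c * ?R b d + g x $ a $ d * ?R b c))
     = ?R a d + g x $ a $ d * scalar_curv g x"
  proof -
    have "(\<Sum>b\<in>UNIV. \<Sum>c\<in>UNIV. ?H $ b $ c * (g x $ a $ c * ?R b d)) = ?R a d"
      by (simp add: inv_contract(1)[OF x] if_distrib[of "\<lambda>u. u * _"] cong: if_cong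
          flip: mult.assoc sum_distrib_right)
    moreover have "(\<Sum>b\<in>UNIV. \<Sum>c\<in>UNIV. ?H $ b $ c * (g x $ a $ d * ?R b c)) = g x $ a $ d * scalar_curv g x"
      by (simp add: scalar_curv_def sum_distrib_left mult.left_commute)
    ultimately show ?thesis
      by (simp add: distrib_left sum.distrib)
  qed
  ultimately have "4 * ?R a d = g x $ a $ d * scalar_curv g x"
    using skew by simp
  then show ?thesis
    by (simp add: mult.commute)
qed

text \<open>Multiplying by the inverse metric raises the index lowered in \<open>riemann_eq\<close>.
  The constant 12 combines the factor 1/3 of the \<open>W\<close>-tensor with the 1/4 of the
  Einstein condition.\<close>

lemma F_constant_curvature_form:
  assumes x: "x \<in> S"
  shows "F a b x = (scalar_curv g x / 12) *\<^sub>R (axis a (g x $ b) - axis b (g x $ a))"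
proof -
  let ?H = "matrix_inv (g x)"
  let ?K = "scalar_curv g x / 12"
  have "transpose (F a b x) = (transpose (F a b x) ** g x) ** ?H"
    by (simp add: matrix_inv_mult(1)[OF g_invertible[OF x]] flip: matrix_mul_assoc)
  moreover have "((transpose (F a b x) ** g x) ** ?H) $ c $ l
      = ?K * ((if l = a then g x $ b $ c else 0) - (if l = b then g x $ a $ c else 0))" for c l
  proof -
    have "((transpose (F a b x) ** g x) ** ?H) $ c $ l = (\<Sum>d\<in>UNIV. riemann g x a b c d * ?H $ d $ l)"
      by (simp add: riemann_eq[OF x] matrix_matrix_mult_def)
    also have "\<dots> = (\<Sum>d\<in>UNIV. ?K * g x $ b $ c * (g x $ a $ d * ?H $ d $ l)
        - ?K * g x $ a $ c * (g x $ b $ d * ?H $ d $ l))"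
      by (rule sum.cong[OF refl]) (simp add: riemann_ricci[OF x] ricci_einstein[OF x] field_simps)
    also have "\<dots> = ?K * ((if l = a then g x $ b $ c else 0) - (if l = b then g x $ a $ c else 0))"
      unfolding sum_subtractf sum_distrib_left[symmetric] inv_contract(3)[OF x]
      by (simp add: right_diff_distrib)
    finally show ?thesis .
  qed
  ultimately have "F a b x $ l $ c
      = ?K * ((if l = a then g x $ b $ c else 0) - (if l = b then g x $ a $ c else 0))" for l c
    by (metis (no_types, lifting) transpose_def vec_lambda_beta)
  then show ?thesis
    by (simp add: vec_eq_iff axis_def)
qed

text \<open>The scalar curvature is recovered from one curvature matrix: because 0 and 1 differ, row
  0 of \<open>F 0 1 y\<close> is a twelfth of it times row 1 of the metric, and contraction with the
  inverse metric removes the metric.\<close>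

lemma scalar_curv_differentiable:
  assumes x: "x \<in> S"
  shows "scalar_curv g differentiable at x"
proof (rule differentiable_cong_open[OF _ open_S x])
  have "(0::4) \<noteq> 1"
    by simp
  then show "12 * (\<Sum>c\<in>UNIV. F 0 1 y $ 0 $ c * matrix_inv (g y) $ c $ 1) = scalar_curv g y"
    if y: "y \<in> S" for y
  proof -
    have "(\<Sum>c\<in>UNIV. F 0 1 y $ 0 $ c * matrix_inv (g y) $ c $ 1)
      = scalar_curv g y / 12 * (\<Sum>c\<in>UNIV. g y $ 1 $ c * matrix_inv (g y) $ c $ 1)"
      by (simp add: F_constant_curvature_form[OF y] axis_def sum_distrib_left mult.assoc)
    then show ?thesis
      by (simp add: inv_contract(3)[OF y])
  qed
  have H: "(\<lambda>y. matrix_inv (g y)) differentiable at x"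
    using twice_differentiable_on_matrix_inv[OF open_S g_twice_differentiable(1) g_invertible] x
    by (rule twice_differentiable_onD)
  have F: "F 0 1 differentiable at x"
    using x \<Gamma>_twice_differentiable by (rule curvature_matrix_differentiable)
  show "(\<lambda>y. 12 * (\<Sum>c\<in>UNIV. F 0 1 y $ 0 $ c * matrix_inv (g y) $ c $ 1)) differentiable at x"
    by (intro differentiable_mult differentiable_const differentiable_sum finite ballI
        bounded_linear_differentiable[OF bounded_linear_entry H]
        bounded_linear_differentiable[OF bounded_linear_entry F])
qed

text \<open>Schur's argument: with the constant-curvature form inserted, a suitable entry of the
  second Bianchi identity contains only the metric and derivatives of the scalar curvature.\<close>

lemma pd_scalar_curv:
  assumes x: "x \<in> S"
  shows "pd e (scalar_curv g) x = 0"
proof -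
  define K where "K y = scalar_curv g y / 12" for y
  have K: "K differentiable at x"
    unfolding K_def[abs_def] divide_inverse using scalar_curv_differentiable[OF x]
    by (intro differentiable_mult differentiable_const)
  have pdK: "pd i K x = pd i (scalar_curv g) x / 12" for i
    unfolding K_def[abs_def]
    using pd_bounded_linear[OF bounded_linear_divide scalar_curv_differentiable[OF x]] .
  \<comment> \<open>\<open>U a b\<close> separates the part of the curvature that is linear in the
    metric from the scalar factor \<open>K\<close>.\<close>
  define U where "U a b G = (axis a (G $ b) - axis b (G $ a) :: real^4^4)" for a b and G :: "real^4^4"
  have U: "bounded_linear (U a b)" for a b
    unfolding U_def by (intro bounded_linear_sub bounded_linear_axis_row)
  have F: "F a b y = K y *\<^sub>R U a b (g y)" if "y \<in> S" for a b y
    using F_constant_curvature_form[OF that] by (simp add: K_def U_def)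
  note Dg = twice_differentiable_onD(1)[OF g_twice_differentiable(1) x]
  have pdF: "pd i (F a b) x = K x *\<^sub>R U a b (transpose (\<Gamma> i x) ** g x + g x ** \<Gamma> i x)
      + pd i K x *\<^sub>R U a b (g x)" for i a b
  proof -
    have "pd i (F a b) x = pd i (\<lambda>y. K y *\<^sub>R U a b (g y)) x"
      using F by (rule pd_cong_open[OF open_S x])
    also have "\<dots> = K x *\<^sub>R U a b (pd i g x) + pd i K x *\<^sub>R U a b (g x)"
      by (simp only: pd_bounded_bilinear[OF bounded_bilinear_scaleR K bounded_linear_differentiable[OF U Dg]]
          pd_bounded_linear[OF U Dg])
    finally show ?thesis
      by (simp only: pd_metric[OF x])
  qed
  \<comment> \<open>These are the Christoffel symbols with the upper index lowered, symmetric in the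
    first two indices.\<close>
  define L where "L i b c = (transpose (\<Gamma> i x) ** g x) $ b $ c" for i b c
  have L_sym: "L i b c = L b i c" for i b c
    unfolding L_def matrix_matrix_mult_def transpose_def by (simp add: \<Gamma>_sym[OF x, of i _ b])
  \<comment> \<open>Of the two terms of \<open>pd_metric\<close>, the one with
    \<open>g x ** \<Gamma> i x\<close> cancels against \<open>F a b x ** \<Gamma> i x\<close>; the
    other one becomes \<open>L\<close>.\<close>
  have entry: "cov_deriv_curvature \<Gamma> i a b x $ l $ c =
      pd i K x * ((if l = a then g x $ b $ c else 0) - (if l = b then g x $ a $ c else 0))
      + K x * ((if l = a then L i b c else 0) - (if l = b then L i a c else 0)
        + \<Gamma> i x $ l $ a * g x $ b $ c - \<Gamma> i x $ l $ b * g x $ a $ c)" for i a b l c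
  proof -
    have 1: "(\<Gamma> i x ** axis a v) $ l $ c = \<Gamma> i x $ l $ a * v $ c" for a v
      by (simp add: matrix_matrix_mult_def axis_def if_distrib[of "\<lambda>v. v $ _"] if_distrib[of "\<lambda>v. _ * v"] cong: if_cong)
    have 2: "(axis a (g x $ b) ** \<Gamma> i x) $ l $ c = (if l = a then (g x ** \<Gamma> i x) $ b $ c else 0)" for a b
      by (simp add: matrix_matrix_mult_def axis_def)
    have 3: "axis a v $ l = (if l = a then v else 0)" for a and v :: "real^4"
      by (simp add: axis_def)
    show ?thesis
      unfolding cov_deriv_curvature_def pdF F[OF x] U_def
      by (simp add: matrix_mult.scaleR_left matrix_mult.scaleR_right matrix_mult.diff_left
          matrix_mult.diff_right 1 2 3 L_def algebra_simps)
  qed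
  \<comment> \<open>Schur's argument needs three distinct indices, hence dimension at least
    3.\<close>
  obtain a b where ab: "a \<noteq> e" "b \<noteq> e" "a \<noteq> b"
  proof -
    have new: "\<exists>i. i \<notin> X" if "card X < 4" for X :: "4 set"
    proof (rule ccontr)
      assume "\<nexists>i. i \<notin> X"
      then have "X = UNIV"
        by auto
      with that show False
        by simp
    qed
    obtain a where "a \<notin> {e}"
      using new[of "{e}"] by auto
    moreover obtain b where "b \<notin> {e, a}"
      using new[of "{e, a}"] by (cases "e = a") auto
    ultimately show ?thesis
      using that by auto
  qed
  \<comment> \<open>Entry \<open>a\<close>, \<open>c\<close> of the Bianchi identity, with no
    summation over \<open>a\<close>: the symmetry of \<open>\<Gamma>\<close> and \<open>L\<close>
    removes every term with the factor \<open>K x\<close>.\<close>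
  have "pd e K x * g x $ b $ c = pd b K x * g x $ e $ c" for c
  proof -
    have "(cov_deriv_curvature \<Gamma> e a b x + cov_deriv_curvature \<Gamma> a b e x
      + cov_deriv_curvature \<Gamma> b e a x) $ a $ c = 0"
      by (simp add: second_bianchi_identity[OF open_S x \<Gamma>_twice_differentiable])
    then show ?thesis
      using ab L_sym[of e b c] \<Gamma>_sym[OF x, of e a a] \<Gamma>_sym[OF x, of e a b] \<Gamma>_sym[OF x, of a a b]
      by (simp add: entry algebra_simps)
  qed
  \<comment> \<open>Contraction with column \<open>b\<close> of the inverse metric gives 1 on the
    left and 0 on the right, as \<open>b\<close> and \<open>e\<close> differ.\<close>
  then have "(\<Sum>c\<in>UNIV. pd e K x * (g x $ b $ c * matrix_inv (g x) $ c $ b))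
      = (\<Sum>c\<in>UNIV. pd b K x * (g x $ e $ c * matrix_inv (g x) $ c $ b))"
    by (simp flip: mult.assoc)
  then have "pd e K x = 0"
    unfolding sum_distrib_left[symmetric] inv_contract(3)[OF x] using ab by simp
  then show ?thesis
    by (simp add: pdK)
qed

end

end

section \<open>The energy-momentum tensor\<close>

lemma spacetime_lorentzian_chart:
  assumes "spacetime A g" "ch \<in> A"
  shows "lorentzian_chart (g ch) (chart_range ch)"
  using assms unfolding lorentzian_chart_def spacetime_def smooth_atlas_def is_chart_def
    lorentzian_metric_def tensor_field_def by auto

lemma transition_coord:
  assumes "is_chart c" "p \<in> chart_dom c"
  shows "transition c c' (coord c p) = coord c' p"
  using homeomorphism_apply1[OF _ assms(2), of "chart_range c" "coord c"
      "inv_into (chart_dom c) (coord c)"] assms(1)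
  by (simp add: is_chart_def transition_def)

text \<open>The transformation law maps zero to zero; the converse is the same law with the two
  charts exchanged.\<close>

lemma tensor_field_zero_iff:
  assumes A: "smooth_atlas A" "tensor_field A T"
    and ch: "c \<in> A" "c' \<in> A" "p \<in> chart_dom c" "p \<in> chart_dom c'"
  shows "T c (coord c p) = 0 \<longleftrightarrow> T c' (coord c' p) = 0"
proof -
  have "T c (coord c p) = 0" if "c \<in> A" "c' \<in> A" "p \<in> chart_dom c" "p \<in> chart_dom c'"
    "T c' (coord c' p) = 0" for c c'
  proof -
    have "coord c p \<in> overlap c c'"
      using that by (auto simp: overlap_def)
    then have "T c (coord c p) = transpose (jacobian (transition c c') (at (coord c p)))
        ** T c' (transition c c' (coord c p)) ** jacobian (transition c c') (at (coord c p))"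
      using A(2) that unfolding tensor_field_def by blast
    moreover have "is_chart c"
      using A(1) that by (auto simp: smooth_atlas_def)
    ultimately show ?thesis
      using that by (simp add: transition_coord)
  qed
  with ch show ?thesis
    by blast
qed

text \<open>For an Einstein metric the field equations say that \<open>k\<close> times
  \<open>T\<close> is the metric times \<Lambda> minus a quarter of the scalar curvature. This
  factor is constant on a ball where the scalar curvature is.\<close>

lemma einstein_W_flat_locally_proportional:
  assumes "spacetime A g" "W_flat A g" "k \<noteq> 0" "einstein_equations A g \<Lambda> k T"
    and ch: "ch \<in> A" and x: "x \<in> chart_range ch"
  obtains r c where "r > 0" "ball x r \<subseteq> chart_range ch" "\<And>y. y \<in> ball x r \<Longrightarrow> T ch y = c *\<^sub>R g ch y"
proof -
  interpret lorentzian_chart "g ch" "chart_range ch"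
    using assms(1) ch by (rule spacetime_lorentzian_chart)
  have W: "w_curv (g ch) y a b c d = 0" if "y \<in> chart_range ch" for y a b c d
    using assms(2) ch that by (auto simp: W_flat_def)
  obtain r where r: "r > 0" "ball x r \<subseteq> chart_range ch"
    "\<And>y. y \<in> ball x r \<Longrightarrow> scalar_curv (g ch) y = scalar_curv (g ch) x"
    using pd_zero_locally_constant[OF open_S x scalar_curv_differentiable[OF W] pd_scalar_curv[OF W]]
    by metis
  have "T ch y = ((\<Lambda> - scalar_curv (g ch) x / 4) / k) *\<^sub>R g ch y" if y: "y \<in> ball x r" for y
  proof -
    have "k * T ch y $ b $ c = (\<Lambda> - scalar_curv (g ch) x / 4) * g ch y $ b $ c" for b c
    proof -
      have "y \<in> chart_range ch"
        using r(2) y by blast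
      then have "k * T ch y $ b $ c = ricci (g ch) y b c - 1/2 * scalar_curv (g ch) y * g ch y $ b $ c
          + \<Lambda> * g ch y $ b $ c"
        using assms(4) ch unfolding einstein_equations_def by metis
      also have "\<dots> = (\<Lambda> - scalar_curv (g ch) x / 4) * g ch y $ b $ c"
        by (simp add: ricci_einstein[OF W \<open>y \<in> chart_range ch\<close>] r(3)[OF y] field_simps)
      finally show ?thesis .
    qed
    then show ?thesis
      using assms(3) by (simp add: vec_eq_iff field_simps)
  qed
  with r that show ?thesis
    by blast
qed

text \<open>Whether \<open>T\<close> vanishes at a point is independent of the chart. It is also
  locally constant: near each point \<open>T\<close> is a fixed multiple of the nowhere zero metric.
  Hence it is constant on each connected component, where \<open>non_vacuum\<close> provides a point
  with non-zero \<open>T\<close>.\<close>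

lemma non_vacuum_nonzero:
  assumes st: "spacetime A g" and T: "tensor_field A T" "non_vacuum A T"
    and proportional: "\<And>ch x. ch \<in> A \<Longrightarrow> x \<in> chart_range ch \<Longrightarrow>
      \<exists>r c. r > 0 \<and> ball x r \<subseteq> chart_range ch \<and> (\<forall>y\<in>ball x r. T ch y = c *\<^sub>R g ch y)"
    and ch: "ch \<in> A" "p \<in> chart_dom ch"
  shows "T ch (coord ch p) \<noteq> 0"
proof -
  have atlas: "smooth_atlas A"
    using st by (simp add: spacetime_def)
  define N where "N q \<longleftrightarrow> (\<exists>ch\<in>A. q \<in> chart_dom ch \<and> T ch (coord ch q) \<noteq> 0)" for q
  have N: "N q \<longleftrightarrow> T ch (coord ch q) \<noteq> 0" if "ch \<in> A" "q \<in> chart_dom ch" for ch q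
  proof
    assume "N q"
    then obtain c where "c \<in> A" "q \<in> chart_dom c" "T c (coord c q) \<noteq> 0"
      unfolding N_def by (elim bexE conjE)
    then show "T ch (coord ch q) \<noteq> 0"
      using tensor_field_zero_iff[OF atlas T(1) \<open>c \<in> A\<close> that(1) _ that(2)] by simp
  next
    assume "T ch (coord ch q) \<noteq> 0"
    with that show "N q"
      unfolding N_def by (intro bexI conjI)
  qed
  define C where "C = connected_component_set UNIV p"
  have C: "C \<in> components UNIV" "p \<in> C"
    by (simp_all add: C_def componentsI)
  have "N constant_on C"
  proof (rule locally_constant_imp_constant)
    show "connected C"
      using C in_components_connected by blast
    fix q assume "q \<in> C"
    have "q \<in> (\<Union>c\<in>A. chart_dom c)"
      using atlas by (simp add: smooth_atlas_def)
    then obtain c where c: "c \<in> A" "q \<in> chart_dom c"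
      by (rule UN_E)
    obtain r s where r: "r > 0" "\<And>y. y \<in> ball (coord c q) r \<Longrightarrow> T c y = s *\<^sub>R g c y"
      using proportional[OF c(1) imageI[OF c(2)]] by blast
    \<comment> \<open>The coordinate ball pulled back to the manifold; it is open because the
      coordinate map is continuous on its open domain.\<close>
    let ?V = "chart_dom c \<inter> coord c -` ball (coord c q) r"
    have "open (chart_dom c)" "continuous_on (chart_dom c) (coord c)"
      using atlas c by (auto simp: smooth_atlas_def is_chart_def homeomorphism_def)
    from continuous_open_preimage[OF this(2,1) open_ball] have "open ?V" .
    have const: "N q' = N q" if "q' \<in> ?V" for q'
    proof -
      have nz: "g c (coord c q'') \<noteq> 0" if "q'' \<in> chart_dom c" for q''
      proof -
        interpret lorentzian_chart "g c" "chart_range c"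
          using st c(1) by (rule spacetime_lorentzian_chart)
        show ?thesis
          using g_invertible[of "coord c q''"] that by (auto simp: invertible_det_nz det_0[unfolded mat_0])
      qed
      have "N q'' \<longleftrightarrow> s \<noteq> 0" if "q'' \<in> ?V" for q''
        using that N[OF c(1), of q''] r(2)[of "coord c q''"] nz[of q''] by simp
      moreover have "q \<in> ?V"
        using c r(1) by simp
      ultimately show ?thesis
        using that by blast
    qed
    show "\<exists>V. openin (top_of_set C) V \<and> q \<in> V \<and> (\<forall>q'\<in>V. N q' = N q)"
    proof (intro exI conjI ballI)
      show "openin (top_of_set C) (C \<inter> ?V)"
        using \<open>open ?V\<close> by (rule openin_open_Int)
      show "q \<in> C \<inter> ?V"
        using \<open>q \<in> C\<close> c(2) r(1) by simp
      show "N q' = N q" if "q' \<in> C \<inter> ?V" for q'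
        using that by (intro const) simp
    qed
  qed
  moreover obtain q where "q \<in> C" "N q"
    using T(2) C(1) unfolding non_vacuum_def N_def by blast
  ultimately have "N p"
    using C(2) by (auto simp: constant_on_def)
  with N[OF ch] show ?thesis
    by simp
qed

text \<open>The factor \<open>c\<close> is constant on a neighbourhood of \<open>x\<close>, so the
  Lie derivative contains no term with a derivative of the factor.\<close>

lemma lie_deriv_proportional:
  assumes S: "open S" "x \<in> S" and g: "g ch differentiable at x"
    and T: "\<And>y. y \<in> S \<Longrightarrow> T ch y = c *\<^sub>R g ch y"
  shows "lie_deriv \<xi> T ch x = c *\<^sub>R lie_deriv \<xi> g ch x"
proof -
  have "pd a (T ch) x = pd a (\<lambda>y. c *\<^sub>R g ch y) x" for a
    using T by (rule pd_cong_open[OF S])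
  moreover have "pd a (\<lambda>y. c *\<^sub>R g ch y) x = c *\<^sub>R pd a (g ch) x" for a
    using g by (rule pd_bounded_linear[OF bounded_linear_scaleR_right])
  ultimately have pd: "pd a (T ch) x = c *\<^sub>R pd a (g ch) x" for a
    by metis
  show ?thesis
    by (simp add: pd lie_deriv_def vec_eq_iff T[OF S(2)] sum_distrib_left algebra_simps)
qed

theorem theorem3p2:
  fixes A :: "'m::{t2_space, second_countable_topology} chart set"
    and g T :: "'m tfield" and \<xi> :: "'m vfield" and \<Lambda> k :: real
  assumes "spacetime A g"
    and "W_flat A g"
    and "k \<noteq> 0"
    and "tensor_field A T"
    and "einstein_equations A g \<Lambda> k T"
    and "non_vacuum A T"
    and "vector_field A \<xi>"
  shows "killing_field A g \<xi> \<longleftrightarrow> vanishes A (lie_deriv \<xi> T)"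
proof -
  have local_prop: "\<exists>r c. r > 0 \<and> ball x r \<subseteq> chart_range ch \<and> (\<forall>y\<in>ball x r. T ch y = c *\<^sub>R g ch y)"
    if "ch \<in> A" "x \<in> chart_range ch" for ch x
    by (rule einstein_W_flat_locally_proportional[OF assms(1-3,5) that]) blast
  \<comment> \<open>Both sides of the claim are pointwise conditions in the charts, so they are
    compared at a single point.\<close>
  have "lie_deriv \<xi> g ch x = 0 \<longleftrightarrow> lie_deriv \<xi> T ch x = 0"
    if ch: "ch \<in> A" and x: "x \<in> chart_range ch" for ch x
  proof -
    interpret lorentzian_chart "g ch" "chart_range ch"
      using assms(1) ch by (rule spacetime_lorentzian_chart)
    obtain r c where r: "r > 0" "\<And>y. y \<in> ball x r \<Longrightarrow> T ch y = c *\<^sub>R g ch y"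
      using local_prop[OF ch x] by blast
    obtain p where "p \<in> chart_dom ch" "x = coord ch p"
      using x by blast
    then have "T ch x \<noteq> 0"
      using non_vacuum_nonzero[OF assms(1,4,6) local_prop ch] by simp
    \<comment> \<open>The centre \<open>x\<close> lies in the ball, so \<open>c = 0\<close> would
      make \<open>T\<close> vanish there.\<close>
    then have "c \<noteq> 0"
      using r by auto
    moreover have "lie_deriv \<xi> T ch x = c *\<^sub>R lie_deriv \<xi> g ch x"
      using r twice_differentiable_onD(1)[OF g_twice_differentiable(1) x]
      by (intro lie_deriv_proportional[of "ball x r"]) auto
    ultimately show ?thesis
      by simp
  qed
  then show ?thesis
    by (simp add: killing_field_def vanishes_def)
qed

end
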